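(* Let $A-\lambda B$, $A,B\in\mathbb{C}^{n\times n}$, be a diagonalizable pencil with only finite eigenvalues, and let $X,Y\in\mathbb{C}^{n\times n}$ and $\tilde\lambda_1,\dots,\tilde\lambda_n\in\mathbb{C}$ be such that \[Y^HAX=\mathrm{diag}(\tilde\lambda_1,\dots,\tilde\lambda_n)+E,\qquad Y^HBX=I+F,\] where $E=(e_{j,l})$ and $F=(f_{j,l})$ have zero diagonal. Put $E_j=\sum_l|e_{j,l}|$, $F_j=\sum_l|f_{j,l}|$, assume $F_j<1$ for all $j$, and put $\rho_j=\frac{|\tilde\lambda_j|F_j+E_j}{1-F_j}$ and $D_j=\{z\in\mathbb{C}:|z-\tilde\lambda_j|\le\rho_j\}$ for $1\le j\le n$. (1) Suppose $\tilde\lambda_i$ is simple, i.e. $\delta:=\min_{j\ne i}|\tilde\lambda_i-\tilde\lambda_j|>0$, and $\delta>\rho_i+\rho_j$ for all $j\ne i$. Then there exists exactly one eigenvalue $\lambda_i$ of the pencil $A-\lambda B$ such that $|\lambda_i-\tilde\lambda_i|\le\rho_i$. (2) Suppose $\tilde\lambda_i$ has multiplicity $k$, $\tilde\lambda_i=\tilde\lambda_{i+1}=\cdots=\tilde\lambda_{i+k-1}$, and the $k$ disks $D_{i+l}$ $(0\le l\le k-1)$ are disjoint from the other $n-k$ disks. Then there exist exactly $k$ eigenvalues $\lambda_j$ $(i\le j\le i+k-1)$ of the pencil $A-\lambda B$ such that $|\lambda_j-\tilde\lambda_i|\le\max_{0\le l\le k-1}\rho_{i+l}$.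
   Context: The finite eigenvalues of the pencil $A-\lambda B$ are the roots of $\det(A-\lambda B)$, counted with multiplicity; having only finite eigenvalues means that there are $n$ of them. $Y^H$ is the conjugate transpose of $Y$. The numbers $\tilde\lambda_j$ play the role of computed eigenvalues, and $X$, $Y$ of normalized computed right and left eigenvectors; "simple" and "multiplicity" refer to the list $\tilde\lambda_1,\dots,\tilde\lambda_n$. *)

theory Defs
  imports
    "Jordan_Normal_Form.Schur_Decomposition"
    "HOL-Computational_Algebra.Polynomial"
    "HOL-Library.Extended_Real"
begin

definition pencil_poly :: "complex mat \<Rightarrow> complex mat \<Rightarrow> complex poly" where
  "pencil_poly A B = det (map_mat (\<lambda>a. [:a:]) A - [:0, 1:] \<cdot>\<^sub>m map_mat (\<lambda>b. [:b:]) B)"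

text \<open>Finite eigenvalues with algebraic multiplicity. For a singular pencil (determinant
  identically zero) this is the empty multiset.\<close>

definition pencil_eigenvalues :: "complex mat \<Rightarrow> complex mat \<Rightarrow> complex multiset" where
  "pencil_eigenvalues A B = proots (pencil_poly A B)"

definition only_finite_eigenvalues :: "complex mat \<Rightarrow> complex mat \<Rightarrow> bool" where
  "only_finite_eigenvalues A B \<longleftrightarrow>
     pencil_poly A B \<noteq> 0 \<and> size (pencil_eigenvalues A B) = dim_row A"

definition diagonalizable_pencil :: "nat \<Rightarrow> complex mat \<Rightarrow> complex mat \<Rightarrow> bool" where
  "diagonalizable_pencil n A B \<longleftrightarrow>
     (\<exists>P \<in> carrier_mat n n. \<exists>Q \<in> carrier_mat n n. invertible_mat P \<and> invertible_mat Q \<and>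
        diagonal_mat (P * A * Q) \<and> diagonal_mat (P * B * Q))"

definition row_abs_sum :: "complex mat \<Rightarrow> nat \<Rightarrow> real" where
  "row_abs_sum M j = (\<Sum>l<dim_col M. cmod (M $$ (j, l)))"

definition pencil_radius :: "(nat \<Rightarrow> complex) \<Rightarrow> complex mat \<Rightarrow> complex mat \<Rightarrow> nat \<Rightarrow> real" where
  "pencil_radius \<mu> E F j =
     (cmod (\<mu> j) * row_abs_sum F j + row_abs_sum E j) / (1 - row_abs_sum F j)"

definition pencil_disk :: "(nat \<Rightarrow> complex) \<Rightarrow> complex mat \<Rightarrow> complex mat \<Rightarrow> nat \<Rightarrow> complex set" where
  "pencil_disk \<mu> E F j = {z. cmod (z - \<mu> j) \<le> pencil_radius \<mu> E F j}"

text \<open>The separation of \<open>\<mu> i\<close> from the other entries of the list. It is extended-real valued so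
  that the minimum over the empty index set (\<open>n = 1\<close>) is \<open>\<infinity>\<close>.\<close>

definition separation :: "nat \<Rightarrow> (nat \<Rightarrow> complex) \<Rightarrow> nat \<Rightarrow> ereal" where
  "separation n \<mu> i = (INF j\<in>{..<n} - {i}. ereal (cmod (\<mu> i - \<mu> j)))"

end

(* Join the pencil diag(mu) - z I to Y^H (A - z B) X by the linear homotopy that scales E and F by t.
   The Gershgorin argument keeps all eigenvalues inside the disks for every t in [0,1], so none of them
   crosses a circle that avoids the disks.  By the argument principle the number of eigenvalues inside
   such a circle is the winding number about 0 of the image of the circle under the characteristic
   polynomial; it is therefore a homotopy invariant and can be read off at t = 0. *)

theory Submission
  imports "HOL-Complex_Analysis.Cauchy_Integral_Formula" Defs
begin

hide_const (open) Determinants.det module.smult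
no_notation Finite_Cartesian_Product.vec_nth (infixl \<open>$\<close> 90)

section \<open>Argument principle for polynomials on a circle\<close>

lemma winding_number_circlepath_if:
  assumes "0 < r" "w \<notin> sphere c r"
  shows "winding_number (circlepath c r) w = (if w \<in> ball c r then 1 else 0)"
proof (cases "w \<in> ball c r")
  case True
  then show ?thesis
    by (simp add: winding_number_circlepath dist_norm norm_minus_commute)
next
  case False
  then have "w \<notin> cball c r"
    using assms by (auto simp: sphere_def)
  moreover have "path_image (circlepath c r) \<subseteq> cball c r"
    using assms(1) by auto
  ultimately have "winding_number (circlepath c r) w = 0"
    by (intro winding_number_zero_outside[of _ "cball c r"]) auto
  then show ?thesis
    using False by simp
qed

text \<open>The logarithmic derivative is additive over a factorisation
  \<open>p = [:-x, 1:] * q\<close>. Each linear factor contributes the integral of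
  \<open>1 / (z - x)\<close>, which is \<open>2 * pi * \<i>\<close> or 0 according as
  \<open>x\<close> lies inside or outside the circle. Induction on the degree adds these up, with
  multiplicity.\<close>

lemma has_contour_integral_logderiv_poly:
  assumes "0 < r" "\<And>z. z \<in> sphere c r \<Longrightarrow> poly p z \<noteq> 0"
  shows "((\<lambda>z. poly (pderiv p) z / poly p z) has_contour_integral
           (2 * pi * \<i> * of_nat (size (filter_mset (\<lambda>z. z \<in> ball c r) (proots p)))))
           (circlepath c r)"
  using assms(2)
proof (induction "degree p" arbitrary: p)
  case 0
  then obtain a where "p = [:a:]"
    by (metis degree_eq_zeroE)
  then show ?case
    by (simp add: pderiv_pCons has_contour_integral_0)
next
  case (Suc d)
  then obtain x where x: "poly p x = 0"
    using fundamental_theorem_of_algebra[of p] by (metis constant_degree nat.distinct(1))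
  then obtain q where pq: "p = [:-x, 1:] * q"
    by (metis dvdE poly_eq_0_iff_dvd)
  have "p \<noteq> 0"
    using Suc.hyps by auto
  with pq have q0: "q \<noteq> 0" by auto
  have "d = degree q"
    using Suc.hyps pq q0 by (simp add: degree_mult_eq del: mult_pCons_left)
  moreover have q: "poly q z \<noteq> 0" if "z \<in> sphere c r" for z
    using Suc.prems[OF that] pq by auto
  ultimately have IH: "((\<lambda>z. poly (pderiv q) z / poly q z) has_contour_integral
           (2 * pi * \<i> * of_nat (size (filter_mset (\<lambda>z. z \<in> ball c r) (proots q)))))
           (circlepath c r)"
    using Suc.hyps by blast
  have xs: "x \<notin> sphere c r"
    using Suc.prems x by blast
  have lin: "((\<lambda>w. 1 / (w - x)) has_contour_integral
               (2 * pi * \<i> * (if x \<in> ball c r then 1 else 0))) (circlepath c r)"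
    using has_contour_integral_winding_number[of "circlepath c r" x] xs \<open>0 < r\<close>
    by (simp add: winding_number_circlepath_if)
  have roots: "proots p = {#x#} + proots q"
    using q0 by (subst pq, subst proots_mult) auto
  have "((\<lambda>z. poly (pderiv p) z / poly p z) has_contour_integral
          (2 * pi * \<i> * (if x \<in> ball c r then 1 else 0) +
           2 * pi * \<i> * of_nat (size (filter_mset (\<lambda>z. z \<in> ball c r) (proots q)))))
          (circlepath c r)"
  proof (rule has_contour_integral_eq[OF has_contour_integral_add[OF lin IH]])
    fix z assume "z \<in> path_image (circlepath c r)"
    then have z: "z \<in> sphere c r"
      using \<open>0 < r\<close> by simp
    with xs have "z - x \<noteq> 0" by auto
    with q[OF z] show "1 / (z - x) + poly (pderiv q) z / poly q z = poly (pderiv p) z / poly p z"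
      unfolding pq pderiv_mult by (simp add: pderiv_pCons field_simps)
  qed
  then show ?case
    unfolding roots by (simp add: algebra_simps split: if_splits)
qed

text \<open>The substitution \<open>w = poly p z\<close> turns the winding integral of
  \<open>1 / w\<close> along the image curve into the integral of the logarithmic derivative along
  the circle.\<close>

lemma winding_number_poly_circlepath:
  assumes "0 < r" "\<And>z. z \<in> sphere c r \<Longrightarrow> poly p z \<noteq> 0"
  shows "winding_number (poly p \<circ> circlepath c r) 0
           = of_nat (size (filter_mset (\<lambda>z. z \<in> ball c r) (proots p)))"
proof -
  let ?g = "circlepath c r"
  have hol: "poly p holomorphic_on UNIV"
    by (intro holomorphic_intros)
  have valid: "valid_path (poly p \<circ> ?g)"
    by (rule valid_path_compose_holomorphic[OF _ hol]) auto
  have "0 \<notin> path_image (poly p \<circ> ?g)"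
    using assms by (force simp: path_image_compose)
  with valid have "winding_number (poly p \<circ> ?g) 0
      = 1 / (2 * pi * \<i>) * contour_integral (poly p \<circ> ?g) (\<lambda>w. 1 / (w - 0))"
    by (rule winding_number_valid_path)
  also have "contour_integral (poly p \<circ> ?g) (\<lambda>w. 1 / (w - 0))
      = contour_integral ?g (\<lambda>w. deriv (poly p) w * (1 / (poly p w - 0)))"
    using hol by (intro contour_integral_comp_analyticW[where s = UNIV]) (auto simp: analytic_on_open)
  also have "\<dots> = contour_integral ?g (\<lambda>w. poly (pderiv p) w / poly p w)"
    by (simp add: DERIV_imp_deriv[OF poly_DERIV])
  also have "\<dots> = 2 * pi * \<i> * of_nat (size (filter_mset (\<lambda>z. z \<in> ball c r) (proots p)))"
    by (rule contour_integral_unique[OF has_contour_integral_logderiv_poly[OF assms]])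
  also have "1 / (2 * pi * \<i>) * \<dots> = of_nat (size (filter_mset (\<lambda>z. z \<in> ball c r) (proots p)))"
    by simp
  finally show ?thesis .
qed

text \<open>Joint continuity in \<open>(t, z)\<close> makes the image curves a homotopy of loops,
  and the absence of roots on the sphere keeps it in the punctured plane, where the winding number
  about 0 is constant.\<close>

lemma size_proots_ball_homotopy:
  fixes Q :: "real \<Rightarrow> complex poly" and c :: complex and r :: real
  assumes r: "0 < r"
    and cont: "continuous_on UNIV (\<lambda>(t, z). poly (Q t) z)"
    and nz: "\<And>t z. t \<in> {0..1} \<Longrightarrow> z \<in> sphere c r \<Longrightarrow> poly (Q t) z \<noteq> 0"
  shows "size (filter_mset (\<lambda>z. z \<in> ball c r) (proots (Q 0)))
           = size (filter_mset (\<lambda>z. z \<in> ball c r) (proots (Q 1)))"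
proof -
  let ?g = "circlepath c r"
  let ?h = "\<lambda>(t, s). poly (Q t) (?g s)"
  have g: "?g s \<in> sphere c r" if "s \<in> {0..1}" for s
    using that r path_image_circlepath[of c r] by (auto simp: path_image_def)
  have "homotopic_loops (- {0}) (poly (Q 0) \<circ> ?g) (poly (Q 1) \<circ> ?g)"
    unfolding homotopic_loops
  proof (intro exI conjI)
    have "continuous_on {0..1} ?g"
      using valid_path_imp_path[OF valid_path_circlepath[of c r]] by (simp add: path_def)
    then have "continuous_on ({0..1} \<times> {0..1}) (\<lambda>x. ?g (snd x))"
      by (rule continuous_on_compose2) (auto intro: continuous_intros)
    then have "continuous_on ({0..1} \<times> {0..1}) (\<lambda>x. (fst x, ?g (snd x)))"
      by (intro continuous_intros)
    from continuous_on_compose2[OF cont this]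
    show "continuous_on ({0..1} \<times> {0..1}) ?h"
      by (simp add: case_prod_unfold)
    show "?h \<in> {0..1} \<times> {0..1} \<rightarrow> - {0}"
      using nz g by auto
    show "\<forall>t\<in>{0..1}. pathfinish (?h \<circ> Pair t) = pathstart (?h \<circ> Pair t)"
      using pathfinish_circlepath[of c r] pathstart_circlepath[of c r]
      by (auto simp: pathfinish_def pathstart_def)
  qed auto
  then have "winding_number (poly (Q 0) \<circ> ?g) 0 = winding_number (poly (Q 1) \<circ> ?g) 0"
    by (rule winding_number_homotopic_loops)
  then show ?thesis
    using winding_number_poly_circlepath[OF r nz[of 0]] winding_number_poly_circlepath[OF r nz[of 1]]
    by simp
qed

section \<open>Determinants: pencil polynomials, diagonal dominance, continuity\<close>

lemma poly_pencil_poly: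
  assumes "A \<in> carrier_mat n n" "B \<in> carrier_mat n n"
  shows "poly (pencil_poly A B) z = det (A - z \<cdot>\<^sub>m B)"
proof -
  have hom: "comm_ring_hom (\<lambda>p. poly p z)"
    by unfold_locales auto
  have "map_mat (\<lambda>p. poly p z) (map_mat (\<lambda>a. [:a:]) A - [:0, 1:] \<cdot>\<^sub>m map_mat (\<lambda>b. [:b:]) B)
          = A - z \<cdot>\<^sub>m B"
    using assms by (intro eq_matI) auto
  then show ?thesis
    unfolding pencil_poly_def by (simp add: comm_ring_hom.hom_det[OF hom, symmetric])
qed

text \<open>Equivalent pencils have the same eigenvalues once the scalar factor is nonzero. Both
  sides are compared at every point \<open>z\<close>, where multiplicativity of the determinant
  applies.\<close>

lemma pencil_poly_mult:
  assumes "P \<in> carrier_mat n n" "A \<in> carrier_mat n n" "B \<in> carrier_mat n n" "X \<in> carrier_mat n n"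
  shows "pencil_poly (P * A * X) (P * B * X) = smult (det P * det X) (pencil_poly A B)"
proof -
  have "poly (pencil_poly (P * A * X) (P * B * X)) z = poly (smult (det P * det X) (pencil_poly A B)) z"
    for z
  proof -
    have "poly (pencil_poly (P * A * X) (P * B * X)) z = det (P * A * X - z \<cdot>\<^sub>m (P * B * X))"
      using assms by (intro poly_pencil_poly[of _ n]) auto
    also have "P * A * X - z \<cdot>\<^sub>m (P * B * X) = P * (A - z \<cdot>\<^sub>m B) * X"
      using assms
      by (simp add: minus_mult_distrib_mat[of _ n n] mult_minus_distrib_mat[of _ n n]
          mult_smult_distrib[of _ n n] mult_smult_assoc_mat[of _ n n])
    also have "det \<dots> = poly (smult (det P * det X) (pencil_poly A B)) z"
    proof -
      have "A - z \<cdot>\<^sub>m B \<in> carrier_mat n n"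
        using assms by auto
      then show ?thesis
        using assms by (simp add: poly_pencil_poly[of _ n] det_mult[of _ n] del: assoc_mult_mat)
    qed
    finally show ?thesis .
  qed
  then show ?thesis
    by (simp add: poly_eq_poly_eq_iff[symmetric] fun_eq_iff)
qed

lemma proots_pencil_poly_diag:
  "proots (pencil_poly (mat_diag n \<mu>) (1\<^sub>m n)) = image_mset \<mu> (mset_set {..<n})"
proof -
  have "poly (pencil_poly (mat_diag n \<mu>) (1\<^sub>m n)) z = poly (\<Prod>j<n. [:\<mu> j, -1:]) z" for z
  proof -
    have "mat_diag n \<mu> - z \<cdot>\<^sub>m 1\<^sub>m n = mat_diag n (\<lambda>j. \<mu> j - z)"
      by (rule eq_matI) (auto simp: mat_diag_def)
    moreover have "det (mat_diag n (\<lambda>j. \<mu> j - z)) = (\<Prod>j<n. \<mu> j - z)"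
      by (subst det_upper_triangular[of _ n])
        (auto simp: mat_diag_def diag_mat_def atLeast0LessThan prod.list_conv_set_nth
          intro!: prod.cong)
    ultimately show ?thesis
      by (simp add: poly_pencil_poly[of _ n] poly_prod)
  qed
  then have "pencil_poly (mat_diag n \<mu>) (1\<^sub>m n) = (\<Prod>j<n. [:\<mu> j, -1:])"
    by (simp add: poly_eq_poly_eq_iff[symmetric] fun_eq_iff)
  \<comment> \<open>The factor is the negative of the monic \<open>[:- a, 1:]\<close>, and a sign
    does not affect roots.\<close>
  moreover have "proots [:a, -1:] = {#a#}" for a :: complex
    using proots_uminus[of "[:- a, 1:]"] by simp
  ultimately show ?thesis
    by (simp add: proots_prod sum_unfold_sum_mset)
qed

text \<open>Contrapositive of the Levy-Desplanques theorem. The row \<open>j\<close> is one where a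
  nonzero kernel vector has an entry of largest modulus; dividing the \<open>j\<close>-th equation
  by that modulus gives the bound.\<close>

lemma det_zero_imp_not_dominant:
  fixes M :: "complex mat"
  assumes M: "M \<in> carrier_mat n n" and "det M = 0"
  obtains j where "j < n" "cmod (M $$ (j, j)) \<le> (\<Sum>l\<in>{..<n} - {j}. cmod (M $$ (j, l)))"
proof -
  obtain v where v: "v \<in> carrier_vec n" "v \<noteq> 0\<^sub>v n" "M *\<^sub>v v = 0\<^sub>v n"
    using assms det_0_iff_vec_prod_zero by blast
  then obtain i where i: "i < n" "v $ i \<noteq> 0"
    by (metis carrier_vecD eq_vecI index_zero_vec(1) index_zero_vec(2))
  let ?S = "(\<lambda>i. cmod (v $ i)) ` {..<n}"
  have "Max ?S \<in> ?S"
    using i by (intro Max_in) auto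
  then obtain j where j: "j < n" "Max ?S = cmod (v $ j)" by auto
  have max: "cmod (v $ l) \<le> cmod (v $ j)" if "l < n" for l
    unfolding j(2)[symmetric] using that by (intro Max_ge) auto
  have pos: "0 < cmod (v $ j)"
    using max[OF i(1)] i(2) by (meson less_le_trans zero_less_norm_iff)
  have "0 = (M *\<^sub>v v) $ j"
    using v j by simp
  also have "\<dots> = (\<Sum>l<n. M $$ (j, l) * v $ l)"
    using M v(1) j(1) by (simp add: scalar_prod_def atLeast0LessThan)
  also have "\<dots> = M $$ (j, j) * v $ j + (\<Sum>l\<in>{..<n} - {j}. M $$ (j, l) * v $ l)"
    using j by (intro sum.remove) auto
  finally have "cmod (M $$ (j, j) * v $ j) = cmod (\<Sum>l\<in>{..<n} - {j}. M $$ (j, l) * v $ l)"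
    by (metis add_eq_0_iff norm_minus_cancel)
  also have "\<dots> \<le> (\<Sum>l\<in>{..<n} - {j}. cmod (M $$ (j, l)) * cmod (v $ j))"
    by (rule sum_norm_le) (auto simp: norm_mult intro!: mult_left_mono max)
  finally have "cmod (M $$ (j, j)) * cmod (v $ j)
      \<le> (\<Sum>l\<in>{..<n} - {j}. cmod (M $$ (j, l))) * cmod (v $ j)"
    by (simp add: norm_mult sum_distrib_right)
  with pos j(1) show thesis
    by (intro that[of j]) auto
qed

text \<open>By the Leibniz formula the determinant is a polynomial in the entries.\<close>

lemma continuous_on_det:
  fixes M :: "'a::topological_space \<Rightarrow> complex mat"
  assumes "\<And>x. M x \<in> carrier_mat n n"
    and "\<And>i j. i < n \<Longrightarrow> j < n \<Longrightarrow> continuous_on S (\<lambda>x. M x $$ (i, j))"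
  shows "continuous_on S (\<lambda>x. det (M x))"
proof -
  have "continuous_on S
      (\<lambda>x. \<Sum>p\<in>{p. p permutes {0..<n}}. signof p * (\<Prod>i = 0..<n. M x $$ (i, p i)))"
    by (intro continuous_intros assms(2)) (use permutes_in_image in fastforce)+
  then show ?thesis
    using assms(1) by (simp add: det_def'[of _ n])
qed

section \<open>Gershgorin disks and root counts along the homotopy\<close>

locale perturbed_diagonal_pencil =
  fixes n :: nat and \<mu> :: "nat \<Rightarrow> complex" and E F :: "complex mat"
  assumes E: "E \<in> carrier_mat n n" and F: "F \<in> carrier_mat n n"
    and E_diag: "\<And>j. j < n \<Longrightarrow> E $$ (j, j) = 0"
    and F_diag: "\<And>j. j < n \<Longrightarrow> F $$ (j, j) = 0"
    and F_small: "\<And>j. j < n \<Longrightarrow> row_abs_sum F j < 1"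
begin

abbreviation \<rho> :: "nat \<Rightarrow> real" where
  "\<rho> \<equiv> pencil_radius \<mu> E F"

definition homotopy :: "real \<Rightarrow> complex poly" where
  "homotopy t = pencil_poly (mat_diag n \<mu> + of_real t \<cdot>\<^sub>m E) (1\<^sub>m n + of_real t \<cdot>\<^sub>m F)"

lemma radius_nonneg: "j < n \<Longrightarrow> 0 \<le> \<rho> j"
  using F_small[of j] unfolding pencil_radius_def row_abs_sum_def
  by (intro divide_nonneg_nonneg add_nonneg_nonneg mult_nonneg_nonneg sum_nonneg) auto

lemma poly_homotopy:
  "poly (homotopy t) z
     = det (mat_diag n \<mu> + of_real t \<cdot>\<^sub>m E - z \<cdot>\<^sub>m (1\<^sub>m n + of_real t \<cdot>\<^sub>m F))"
  unfolding homotopy_def using E F by (intro poly_pencil_poly) auto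

text \<open>At a root the matrix is singular, so diagonal dominance fails in some row
  \<open>j\<close>. This bounds \<open>|z - \<mu> j|\<close> by row sums involving
  \<open>|z|\<close>, and \<open>|z| \<le> |z - \<mu> j| + |\<mu> j|\<close> lets the inequality be
  solved for \<open>|z - \<mu> j|\<close>, since \<open>row_abs_sum F j < 1\<close>.\<close>

lemma homotopy_root_in_disk:
  assumes t: "t \<in> {0..1}" and root: "poly (homotopy t) z = 0"
  obtains j where "j < n" "cmod (z - \<mu> j) \<le> \<rho> j"
proof -
  let ?M = "mat_diag n \<mu> + of_real t \<cdot>\<^sub>m E - z \<cdot>\<^sub>m (1\<^sub>m n + of_real t \<cdot>\<^sub>m F)"
  have "?M \<in> carrier_mat n n"
    using E F by auto
  then obtain j where j: "j < n" "cmod (?M $$ (j, j)) \<le> (\<Sum>l\<in>{..<n} - {j}. cmod (?M $$ (j, l)))"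
    using root poly_homotopy det_zero_imp_not_dominant by metis
  have "?M $$ (j, j) = \<mu> j - z"
    using j E F E_diag F_diag by (simp add: mat_diag_def)
  then have "cmod (z - \<mu> j) \<le> (\<Sum>l\<in>{..<n} - {j}. cmod (?M $$ (j, l)))"
    using j by (simp add: norm_minus_commute)
  also have "\<dots> \<le> (\<Sum>l\<in>{..<n} - {j}. cmod (E $$ (j, l)) + cmod z * cmod (F $$ (j, l)))"
  proof (rule sum_mono)
    fix l assume l: "l \<in> {..<n} - {j}"
    \<comment> \<open>Off the diagonal only the perturbations remain, with the common factor
      \<open>t\<close> of modulus at most 1; hence the radius is uniform in
      \<open>t\<close>.\<close>
    then have "?M $$ (j, l) = of_real t * (E $$ (j, l) - z * F $$ (j, l))"
      using j E F by (simp add: mat_diag_def algebra_simps)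
    then have "cmod (?M $$ (j, l)) \<le> cmod (E $$ (j, l) - z * F $$ (j, l))"
      using t by (simp add: norm_mult mult_left_le_one_le)
    also have "\<dots> \<le> cmod (E $$ (j, l)) + cmod z * cmod (F $$ (j, l))"
      by (metis norm_mult norm_triangle_ineq4)
    finally show "cmod (?M $$ (j, l)) \<le> cmod (E $$ (j, l)) + cmod z * cmod (F $$ (j, l))" .
  qed
  also have "\<dots> \<le> (\<Sum>l<n. cmod (E $$ (j, l)) + cmod z * cmod (F $$ (j, l)))"
    by (rule sum_mono2) auto
  also have "\<dots> = row_abs_sum E j + cmod z * row_abs_sum F j"
    using E F by (simp add: row_abs_sum_def sum.distrib sum_distrib_left)
  also have "\<dots> \<le> row_abs_sum E j + (cmod (z - \<mu> j) + cmod (\<mu> j)) * row_abs_sum F j"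
    using norm_triangle_ineq[of "z - \<mu> j" "\<mu> j"]
    by (intro add_left_mono mult_right_mono) (auto simp: row_abs_sum_def sum_nonneg)
  finally have "cmod (z - \<mu> j) * (1 - row_abs_sum F j)
      \<le> cmod (\<mu> j) * row_abs_sum F j + row_abs_sum E j"
    by (simp add: algebra_simps)
  then have "cmod (z - \<mu> j) \<le> \<rho> j"
    using F_small[OF j(1)] by (simp add: pencil_radius_def pos_le_divide_eq)
  with j(1) show thesis
    by (rule that)
qed

text \<open>The condition \<open>sep\<close> puts each disk strictly inside or strictly outside the
  circle, so no root ever lies on it; the count is then that of the diagonal pencil.\<close>

lemma size_homotopy_roots_ball:
  assumes r: "0 < r"
    and sep: "\<And>j. j < n \<Longrightarrow> cmod (\<mu> j - c) + \<rho> j < r \<or> r + \<rho> j < cmod (\<mu> j - c)"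
  shows "size (filter_mset (\<lambda>z. z \<in> ball c r) (proots (homotopy 1)))
           = card {j. j < n \<and> \<mu> j \<in> ball c r}"
proof -
  have "continuous_on UNIV (\<lambda>x. poly (homotopy (fst x)) (snd x))"
    unfolding poly_homotopy
  proof (rule continuous_on_det[where n = n])
    fix i j assume "i < n" "j < n"
    then show "continuous_on UNIV (\<lambda>x :: real \<times> complex. (mat_diag n \<mu> + of_real (fst x) \<cdot>\<^sub>m E
        - snd x \<cdot>\<^sub>m (1\<^sub>m n + of_real (fst x) \<cdot>\<^sub>m F)) $$ (i, j))"
      using E F by (simp add: mat_diag_def) (intro conjI impI continuous_intros)
  qed (use E F in auto)
  then have cont: "continuous_on UNIV (\<lambda>(t, z). poly (homotopy t) z)"
    by (simp add: case_prod_unfold)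
  have nz: "poly (homotopy t) z \<noteq> 0" if t: "t \<in> {0..1}" and z: "z \<in> sphere c r" for t z
  proof
    assume "poly (homotopy t) z = 0"
    with t obtain j where j: "j < n" "cmod (z - \<mu> j) \<le> \<rho> j"
      by (rule homotopy_root_in_disk)
    have "cmod (z - c) = r"
      using z by (simp add: dist_norm norm_minus_commute)
    then show False
      \<comment> \<open>The first triangle inequality refutes the first alternative of
        \<open>sep\<close>, the second one refutes the other.\<close>
      using sep[OF j(1)] j(2) norm_triangle_ineq[of "z - \<mu> j" "\<mu> j - c"]
        norm_triangle_ineq[of "\<mu> j - z" "z - c"] norm_minus_commute[of z "\<mu> j"]
      by simp
  qed
  have "mat_diag n \<mu> + 0 \<cdot>\<^sub>m E = mat_diag n \<mu>" "1\<^sub>m n + 0 \<cdot>\<^sub>m F = 1\<^sub>m n"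
    using E F by (auto simp: mat_diag_def)
  then have "homotopy 0 = pencil_poly (mat_diag n \<mu>) (1\<^sub>m n)"
    by (simp add: homotopy_def)
  then have "size (filter_mset (\<lambda>z. z \<in> ball c r) (proots (homotopy 0)))
      = card {j \<in> {..<n}. \<mu> j \<in> ball c r}"
    by (simp add: proots_pencil_poly_diag filter_mset_image_mset del: mem_ball)
  then show ?thesis
    using size_proots_ball_homotopy[OF r cont nz] by simp
qed

text \<open>The matrix is strictly diagonally dominant: its diagonal entries are 1 and its
  off-diagonal row sums are below 1.\<close>

lemma det_one_plus_nonzero: "det (1\<^sub>m n + F) \<noteq> 0"
proof
  assume "det (1\<^sub>m n + F) = 0"
  then obtain j where j: "j < n"
      "cmod ((1\<^sub>m n + F) $$ (j, j)) \<le> (\<Sum>l\<in>{..<n} - {j}. cmod ((1\<^sub>m n + F) $$ (j, l)))"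
    using F by (metis add_carrier_mat det_zero_imp_not_dominant)
  then have "1 \<le> (\<Sum>l\<in>{..<n} - {j}. cmod (F $$ (j, l)))"
    using F F_diag by simp
  also have "\<dots> \<le> row_abs_sum F j"
    unfolding row_abs_sum_def using F by (intro sum_mono2) auto
  finally show False
    using F_small[OF j(1)] by simp
qed

text \<open>Serves both claims, with \<open>J\<close> a singleton or a block of consecutive indices.
  The disks of \<open>J\<close> are concentric, so their union is the largest of them, of radius
  \<open>R\<close>. A slightly larger circle still misses the finitely many other disks, and the
  ring in between contains no roots.\<close>

lemma size_homotopy_roots_cluster:
  assumes J: "J \<subseteq> {..<n}" "J \<noteq> {}" and same: "\<And>j. j \<in> J \<Longrightarrow> \<mu> j = c"
    and disj: "\<And>i j. i \<in> J \<Longrightarrow> j < n \<Longrightarrow> j \<notin> J \<Longrightarrow>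
        pencil_disk \<mu> E F i \<inter> pencil_disk \<mu> E F j = {}"
  shows "size (filter_mset (\<lambda>z. cmod (z - c) \<le> Max (\<rho> ` J)) (proots (homotopy 1))) = card J"
proof -
  have finJ: "finite J"
    using J finite_subset by blast
  define R where "R = Max (\<rho> ` J)"
  have "R \<in> \<rho> ` J"
    unfolding R_def using finJ J by (intro Max_in) auto
  then obtain m where m: "m \<in> J" "\<rho> m = R" by auto
  have R: "0 \<le> R"
    using m J radius_nonneg by auto
  have le_R: "\<rho> j \<le> R" if "j \<in> J" for j
    unfolding R_def using finJ that by auto
  have far: "R < cmod (\<mu> j - c) - \<rho> j" if j: "j < n" "j \<notin> J" for j
  proof (rule ccontr)
    assume "\<not> ?thesis"
    then have close: "cmod (\<mu> j - c) \<le> R + \<rho> j" by simp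
    \<comment> \<open>the point of the segment from \<open>c\<close> to \<open>\<mu> j\<close> at distance \<open>min R |\<mu> j - c|\<close> from \<open>c\<close>\<close>
    define d where "d = cmod (\<mu> j - c)"
    define z where "z = c + of_real (min R d) * sgn (\<mu> j - c)"
    \<comment> \<open>This includes the case \<open>\<mu> j = c\<close>, where \<open>d\<close> and
      the sign are both 0; for that reason the norm below is only bounded, not computed.\<close>
    have "\<mu> j - c = of_real d * sgn (\<mu> j - c)"
      by (simp add: d_def sgn_eq)
    then have "z - \<mu> j = of_real (min R d - d) * sgn (\<mu> j - c)"
      unfolding z_def by (simp add: algebra_simps)
    then have "cmod (z - \<mu> j) \<le> \<bar>min R d - d\<bar>"
      by (simp add: norm_mult norm_sgn del: of_real_diff)
    then have "cmod (z - \<mu> j) \<le> \<rho> j"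
      using close radius_nonneg[OF j(1)] by (simp add: d_def)
    moreover have "cmod (z - c) \<le> R"
      using R by (auto simp: z_def norm_mult norm_sgn d_def)
    ultimately have "z \<in> pencil_disk \<mu> E F m \<inter> pencil_disk \<mu> E F j"
      using m same by (simp add: pencil_disk_def)
    then show False
      using disj[OF m(1) j] by blast
  qed
  \<comment> \<open>The distance from \<open>c\<close> to the nearest disk outside \<open>J\<close>,
    capped at \<open>R + 1\<close>; the cap keeps the set nonempty when \<open>J\<close> contains
    every index.\<close>
  define b where "b = Min (insert (R + 1) ((\<lambda>j. cmod (\<mu> j - c) - \<rho> j) ` ({..<n} - J)))"
  have "R < b"
    unfolding b_def using far by (subst Min_gr_iff) auto
  then obtain r where r: "R < r" "r < b"
    using dense by blast
  have out: "r < cmod (\<mu> j - c) - \<rho> j" if "j < n" "j \<notin> J" for j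
  proof -
    have "b \<le> cmod (\<mu> j - c) - \<rho> j"
      unfolding b_def using that by (intro Min_le) auto
    with r show ?thesis by simp
  qed
  have "size (filter_mset (\<lambda>z. z \<in> ball c r) (proots (homotopy 1)))
      = card {j. j < n \<and> \<mu> j \<in> ball c r}"
  proof (rule size_homotopy_roots_ball)
    show "0 < r"
      using R r by simp
    show "cmod (\<mu> j - c) + \<rho> j < r \<or> r + \<rho> j < cmod (\<mu> j - c)" if "j < n" for j
    proof (cases "j \<in> J")
      case True
      then show ?thesis
        using same le_R[OF True] r by simp
    next
      case False
      then show ?thesis
        using out[OF that] by simp
    qed
  qed
  also have "{j. j < n \<and> \<mu> j \<in> ball c r} = J"
  proof -
    have "\<mu> j \<in> ball c r \<longleftrightarrow> j \<in> J" if "j < n" for j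
    proof (cases "j \<in> J")
      case True
      then show ?thesis
        using same R r by simp
    next
      case False
      then show ?thesis
        using out[OF that] radius_nonneg[OF that] by (simp add: dist_norm norm_minus_commute)
    qed
    then show ?thesis
      using J by auto
  qed
  \<comment> \<open>Every root lies in some disk: those of \<open>J\<close> stay within distance
    \<open>R\<close> of \<open>c\<close>, all others beyond \<open>r\<close>. So the open ball and
    the smaller closed disk select the same roots.\<close>
  also have "filter_mset (\<lambda>z. z \<in> ball c r) (proots (homotopy 1))
      = filter_mset (\<lambda>z. cmod (z - c) \<le> R) (proots (homotopy 1))"
  proof (rule filter_mset_cong[OF refl])
    fix z assume "z \<in># proots (homotopy 1)"
    \<comment> \<open>\<open>proots\<close> of the zero polynomial is empty, so that case is
      vacuous.\<close>
    then have root: "poly (homotopy 1) z = 0"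
      by (cases "homotopy 1 = 0") auto
    have "(1 :: real) \<in> {0..1}"
      by simp
    from this root obtain j where j: "j < n" "cmod (z - \<mu> j) \<le> \<rho> j"
      by (rule homotopy_root_in_disk)
    show "z \<in> ball c r \<longleftrightarrow> cmod (z - c) \<le> R"
    proof (cases "j \<in> J")
      case True
      then show ?thesis
        using j same le_R[OF True] r by (simp add: dist_norm norm_minus_commute)
    next
      case False
      have "r < cmod (z - c)"
        using out[OF j(1) False] j(2) norm_triangle_ineq[of "\<mu> j - z" "z - c"]
          norm_minus_commute[of z "\<mu> j"] by simp
      then show ?thesis
        using r by (simp add: dist_norm norm_minus_commute)
    qed
  qed
  finally show ?thesis
    by (simp add: R_def)
qed

end

section \<open>Transfer to the original pencil and the two claims\<close>

theorem mainTheorem7: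
  fixes n :: nat
    and A B X Y E F :: "complex mat"
    and \<mu> :: "nat \<Rightarrow> complex"
  assumes A: "A \<in> carrier_mat n n" and B: "B \<in> carrier_mat n n"
    and X: "X \<in> carrier_mat n n" and Y: "Y \<in> carrier_mat n n"
    and E: "E \<in> carrier_mat n n" and F: "F \<in> carrier_mat n n"
    and diagonalizable: "diagonalizable_pencil n A B"
    and finite_eigs: "only_finite_eigenvalues A B"
    and YAX: "mat_adjoint Y * A * X = mat_diag n \<mu> + E"
    and YBX: "mat_adjoint Y * B * X = 1\<^sub>m n + F"
    and E_diag: "\<And>j. j < n \<Longrightarrow> E $$ (j, j) = 0"
    and F_diag: "\<And>j. j < n \<Longrightarrow> F $$ (j, j) = 0"
    and F_small: "\<And>j. j < n \<Longrightarrow> row_abs_sum F j < 1"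
  shows
    "(\<forall>i<n.
        separation n \<mu> i > 0 \<longrightarrow>
        (\<forall>j<n. j \<noteq> i \<longrightarrow>
           separation n \<mu> i > ereal (pencil_radius \<mu> E F i + pencil_radius \<mu> E F j)) \<longrightarrow>
        (\<exists>lam. {# z \<in># pencil_eigenvalues A B. cmod (z - \<mu> i) \<le> pencil_radius \<mu> E F i #}
                 = {# lam #}))
     \<and>
     (\<forall>i<n. \<forall>k.
        i + k \<le> n \<longrightarrow>
        card {j. j < n \<and> \<mu> j = \<mu> i} = k \<longrightarrow>
        (\<forall>l<k. \<mu> (i + l) = \<mu> i) \<longrightarrow>
        (\<forall>l<k. \<forall>j<n. j \<notin> {i..<i + k} \<longrightarrow>
           pencil_disk \<mu> E F (i + l) \<inter> pencil_disk \<mu> E F j = {}) \<longrightarrow>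
        size {# z \<in># pencil_eigenvalues A B.
                cmod (z - \<mu> i) \<le> Max ((\<lambda>l. pencil_radius \<mu> E F (i + l)) ` {..<k}) #} = k)"
proof -
  interpret perturbed_diagonal_pencil n \<mu> E F
    by unfold_locales (fact E F E_diag F_diag F_small)+
  let ?P = "mat_adjoint Y"
  have P: "?P \<in> carrier_mat n n"
    using Y unfolding mat_adjoint_def by auto
  \<comment> \<open>The right side is \<open>det (1\<^sub>m n + F)\<close>, which is nonzero. Hence
    so are the determinants of the two outer factors, and multiplying by them preserves the
    eigenvalues.\<close>
  have "det ?P * det B * det X = det (?P * B * X)"
    using P B X by (simp add: det_mult[of _ n])
  then have "det ?P * det X \<noteq> 0"
    using det_one_plus_nonzero YBX by auto
  moreover have "1 \<cdot>\<^sub>m E = E" "1 \<cdot>\<^sub>m F = F"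
    by auto
  then have "homotopy 1 = smult (det ?P * det X) (pencil_poly A B)"
    using pencil_poly_mult[OF P A B X] by (simp add: homotopy_def YAX YBX)
  ultimately have eigs: "proots (homotopy 1) = pencil_eigenvalues A B"
    by (simp add: pencil_eigenvalues_def)
  note cluster = size_homotopy_roots_cluster[unfolded eigs]
  show ?thesis
  proof (intro conjI allI impI)
    fix i assume i: "i < n"
      and sep: "\<forall>j<n. j \<noteq> i \<longrightarrow> separation n \<mu> i > ereal (\<rho> i + \<rho> j)"
    have "pencil_disk \<mu> E F i \<inter> pencil_disk \<mu> E F j = {}" if j: "j < n" "j \<noteq> i" for j
    proof -
      \<comment> \<open>Thus the distance of the two centres exceeds the sum of the radii, which
        makes the closed disks disjoint.\<close>
      have "separation n \<mu> i \<le> ereal (cmod (\<mu> i - \<mu> j))"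
        unfolding separation_def using j by (intro INF_lower) auto
      then have "ereal (\<rho> i + \<rho> j) < ereal (cmod (\<mu> i - \<mu> j))"
        using sep j less_le_trans by blast
      then show ?thesis
        using disjoint_cballI[of "\<rho> i" "\<rho> j" "\<mu> i" "\<mu> j"]
        by (auto simp: pencil_disk_def cball_def dist_norm norm_minus_commute)
    qed
    then have "size {# z \<in># pencil_eigenvalues A B. cmod (z - \<mu> i) \<le> \<rho> i #} = 1"
      using cluster[of "{i}" "\<mu> i"] i by simp
    \<comment> \<open>The count includes multiplicity, so size 1 also makes the eigenvalue
      simple.\<close>
    then show "\<exists>lam. {# z \<in># pencil_eigenvalues A B. cmod (z - \<mu> i) \<le> \<rho> i #} = {# lam #}"
      by (simp add: size_1_singleton_mset)
  next
    fix i k assume i: "i < n" and k: "i + k \<le> n" "card {j. j < n \<and> \<mu> j = \<mu> i} = k"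
      and same: "\<forall>l<k. \<mu> (i + l) = \<mu> i"
      and disj: "\<forall>l<k. \<forall>j<n. j \<notin> {i..<i + k} \<longrightarrow>
           pencil_disk \<mu> E F (i + l) \<inter> pencil_disk \<mu> E F j = {}"
    \<comment> \<open>The set contains \<open>i\<close>, so \<open>k\<close> is positive and the
      maximum of the radii is taken over a nonempty set.\<close>
    have "finite {j. j < n \<and> \<mu> j = \<mu> i}"
      by simp
    then have "k \<noteq> 0"
      using i k(2) card_gt_0_iff by blast
    have img: "(\<lambda>l. \<rho> (i + l)) ` {..<k} = \<rho> ` {i..<i + k}"
    proof -
      have "(\<lambda>l. \<rho> (i + l)) ` {..<k} = \<rho> ` ((+) i ` {..<k})"
        by (simp add: image_image)
      also have "(+) i ` {..<k} = {i..<i + k}"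
        by (simp add: lessThan_atLeast0 add.commute)
      finally show ?thesis .
    qed
    have offset: "\<exists>l<k. j = i + l" if "j \<in> {i..<i + k}" for j
      using that by (intro exI[of _ "j - i"]) auto
    have "size {# z \<in># pencil_eigenvalues A B. cmod (z - \<mu> i) \<le> Max (\<rho> ` {i..<i + k}) #}
        = card {i..<i + k}"
    proof (rule cluster)
      show "\<mu> j = \<mu> i" if "j \<in> {i..<i + k}" for j
        using offset[OF that] same by auto
      show "pencil_disk \<mu> E F j \<inter> pencil_disk \<mu> E F j' = {}"
        if "j \<in> {i..<i + k}" "j' < n" "j' \<notin> {i..<i + k}" for j j'
        using offset[OF that(1)] disj that by blast
    qed (use k \<open>k \<noteq> 0\<close> in auto)
    then show "size {# z \<in># pencil_eigenvalues A B.
        cmod (z - \<mu> i) \<le> Max ((\<lambda>l. \<rho> (i + l)) ` {..<k}) #} = k"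
      by (simp add: img)
  qed
qed

end
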